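(* Let $X,Y$ be topological spaces, let $\phi:X\to Y$ be a continuous, quasi $H^*$-closed surjection, and suppose that $X$ is $H^*$-normal. Then $Y$ is normal.
   Context: No separation axioms are assumed. Let $X$ be a topological space and $A\subseteq X$. $A$ is semi-closed if $\operatorname{int}(\operatorname{cl}(A))\subseteq A$, and semi-open if its complement is semi-closed; $s\text{-}\operatorname{cl}(A)$ is the intersection of all semi-closed sets containing $A$. $A$ is $w$-closed if $\operatorname{cl}(A)\subseteq U$ whenever $A\subseteq U$ and $U$ is semi-open; $w$-open means complement of $w$-closed. $A$ is $h$-closed if $s\text{-}\operatorname{cl}(A)\subseteq U$ whenever $A\subseteq U$ and $U$ is $w$-open; $h\text{-}\operatorname{cl}(A)$ is the intersection of all $h$-closed sets containing $A$. A set $V$ is an $\alpha^*$-set if $\operatorname{int}(\operatorname{cl}(\operatorname{int}(V)))=\operatorname{int}(V)$; a $C$-set is a set of the form $U\cap V$ with $U$ open and $V$ an $\alpha^*$-set. $A$ is $hCg$-closed if $h\text{-}\operatorname{cl}(A)\subseteq U$ whenever $A\subseteq U$ and $U$ is a $C$-set; $hCg$-open means complement of $hCg$-closed. $A$ is $H^*$-closed if $h\text{-}\operatorname{cl}(A)\subseteq U$ whenever $A\subseteq U$ and $U$ is $hCg$-open; $H^*$-open means complement of $H^*$-closed. $X$ is normal (respectively $H^*$-normal) if for any pair of disjoint closed sets $A,B\subseteq X$ there exist disjoint open (respectively $H^*$-open) sets $U,V$ with $A\subseteq U$ and $B\subseteq V$ (no $T_1$ assumption). A function $\phi:X\to Y$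 is quasi $H^*$-closed if $\phi(D)$ is closed in $Y$ for every $H^*$-closed set $D\subseteq X$. *)

theory Defs
  imports "HOL-Analysis.Analysis"
begin

text \<open>All set predicates below entail containment in \<^term>\<open>topspace X\<close>, and complements are
  taken relative to \<^term>\<open>topspace X\<close>. The closure operators are meant for subsets of
  \<^term>\<open>topspace X\<close>; for these, \<^term>\<open>topspace X\<close> itself belongs to the intersected family,
  so the intersection is never the one of the empty family.\<close>

definition semi_closed :: "'a topology \<Rightarrow> 'a set \<Rightarrow> bool" where
  "semi_closed X A \<longleftrightarrow> A \<subseteq> topspace X \<and> X interior_of (X closure_of A) \<subseteq> A"

definition semi_open :: "'a topology \<Rightarrow> 'a set \<Rightarrow> bool" where
  "semi_open X A \<longleftrightarrow> A \<subseteq> topspace X \<and> semi_closed X (topspace X - A)"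

definition semi_closure :: "'a topology \<Rightarrow> 'a set \<Rightarrow> 'a set" where
  "semi_closure X A = \<Inter>{F. semi_closed X F \<and> A \<subseteq> F}"

definition w_closed :: "'a topology \<Rightarrow> 'a set \<Rightarrow> bool" where
  "w_closed X A \<longleftrightarrow> A \<subseteq> topspace X \<and>
     (\<forall>U. semi_open X U \<and> A \<subseteq> U \<longrightarrow> X closure_of A \<subseteq> U)"

definition w_open :: "'a topology \<Rightarrow> 'a set \<Rightarrow> bool" where
  "w_open X A \<longleftrightarrow> A \<subseteq> topspace X \<and> w_closed X (topspace X - A)"

definition h_closed :: "'a topology \<Rightarrow> 'a set \<Rightarrow> bool" where
  "h_closed X A \<longleftrightarrow> A \<subseteq> topspace X \<and>
     (\<forall>U. w_open X U \<and> A \<subseteq> U \<longrightarrow> semi_closure X A \<subseteq> U)"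

definition h_closure :: "'a topology \<Rightarrow> 'a set \<Rightarrow> 'a set" where
  "h_closure X A = \<Inter>{F. h_closed X F \<and> A \<subseteq> F}"

definition alpha_star_set :: "'a topology \<Rightarrow> 'a set \<Rightarrow> bool" where
  "alpha_star_set X V \<longleftrightarrow> V \<subseteq> topspace X \<and>
     X interior_of (X closure_of (X interior_of V)) = X interior_of V"

definition C_set :: "'a topology \<Rightarrow> 'a set \<Rightarrow> bool" where
  "C_set X A \<longleftrightarrow> (\<exists>U V. openin X U \<and> alpha_star_set X V \<and> A = U \<inter> V)"

definition hCg_closed :: "'a topology \<Rightarrow> 'a set \<Rightarrow> bool" where
  "hCg_closed X A \<longleftrightarrow> A \<subseteq> topspace X \<and>
     (\<forall>U. C_set X U \<and> A \<subseteq> U \<longrightarrow> h_closure X A \<subseteq> U)"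

definition hCg_open :: "'a topology \<Rightarrow> 'a set \<Rightarrow> bool" where
  "hCg_open X A \<longleftrightarrow> A \<subseteq> topspace X \<and> hCg_closed X (topspace X - A)"

definition Hstar_closed :: "'a topology \<Rightarrow> 'a set \<Rightarrow> bool" where
  "Hstar_closed X A \<longleftrightarrow> A \<subseteq> topspace X \<and>
     (\<forall>U. hCg_open X U \<and> A \<subseteq> U \<longrightarrow> h_closure X A \<subseteq> U)"

definition Hstar_open :: "'a topology \<Rightarrow> 'a set \<Rightarrow> bool" where
  "Hstar_open X A \<longleftrightarrow> A \<subseteq> topspace X \<and> Hstar_closed X (topspace X - A)"

definition Hstar_normal_space :: "'a topology \<Rightarrow> bool" where
  "Hstar_normal_space X \<longleftrightarrow>
     (\<forall>A B. closedin X A \<and> closedin X B \<and> disjnt A B \<longrightarrow>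
        (\<exists>U V. Hstar_open X U \<and> Hstar_open X V \<and> A \<subseteq> U \<and> B \<subseteq> V \<and> disjnt U V))"

definition quasi_Hstar_closed_map :: "'a topology \<Rightarrow> 'b topology \<Rightarrow> ('a \<Rightarrow> 'b) \<Rightarrow> bool" where
  "quasi_Hstar_closed_map X Y f \<longleftrightarrow> (\<forall>D. Hstar_closed X D \<longrightarrow> closedin Y (f ` D))"

end

theory Submission imports Defs begin

text \<open>Continuity pulls disjoint closed sets of \<open>Y\<close> back to disjoint closed sets
  of \<open>X\<close>, which \<open>Hstar_normal_space\<close> separates by disjoint
  \<open>Hstar_open\<close> sets. Images of these need be neither open nor disjoint, so each such
  set W is sent instead to the complement of the image of its complement. This is open by
  \<open>openin_compl_image_quasi_Hstar_closed_map\<close>, since the complement of W is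
  \<open>Hstar_closed\<close>.\<close>

lemma openin_compl_image_quasi_Hstar_closed_map:
  assumes "quasi_Hstar_closed_map X Y f" and "Hstar_open X U"
  shows "openin Y (topspace Y - f ` (topspace X - U))"
  using assms unfolding quasi_Hstar_closed_map_def Hstar_open_def
  by (blast intro: openin_diff)

theorem theorem4p1:
  fixes X :: "'a topology" and Y :: "'b topology" and \<phi> :: "'a \<Rightarrow> 'b"
  assumes "continuous_map X Y \<phi>"
    and "quasi_Hstar_closed_map X Y \<phi>"
    and "\<phi> ` topspace X = topspace Y"
    and "Hstar_normal_space X"
  shows "normal_space Y"
  unfolding normal_space_def
proof (intro allI impI)
  fix A B assume AB: "closedin Y A \<and> closedin Y B \<and> disjnt A B"
  let ?pre = "\<lambda>S. {x \<in> topspace X. \<phi> x \<in> S}"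
  have "closedin X (?pre A)" "closedin X (?pre B)" "disjnt (?pre A) (?pre B)"
    using AB closedin_continuous_map_preimage[OF assms(1)] by (auto simp: disjnt_iff)
  then obtain U V where UV: "Hstar_open X U" "Hstar_open X V"
      "?pre A \<subseteq> U" "?pre B \<subseteq> V" "disjnt U V"
    using assms(4) unfolding Hstar_normal_space_def by meson
  \<comment> \<open>The points of \<open>Y\<close> whose whole fibre lies in W; hence
    \<open>?core U\<close> contains A as soon as U contains the preimage of A.\<close>
  let ?core = "\<lambda>W. topspace Y - \<phi> ` (topspace X - W)"
  have "openin Y (?core U)" "openin Y (?core V)"
    using openin_compl_image_quasi_Hstar_closed_map[OF assms(2)] UV(1,2) by auto
  moreover have "A \<subseteq> ?core U" "B \<subseteq> ?core V"
    using AB closedin_subset[of Y] UV(3,4) by blast+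
  moreover have "disjnt (?core U) (?core V)"
    unfolding disjnt_iff
  proof (intro allI notI, elim conjE)
    fix y assume y: "y \<in> ?core U" "y \<in> ?core V"
    \<comment> \<open>Surjectivity makes the fibre over y nonempty, yet it would lie in both U and
      V.\<close>
    then obtain x where "x \<in> topspace X" "y = \<phi> x"
      using assms(3) by blast
    with y UV(5) show False
      by (auto simp: disjnt_iff)
  qed
  ultimately show "\<exists>U V. openin Y U \<and> openin Y V \<and> A \<subseteq> U \<and> B \<subseteq> V \<and> disjnt U V"
    by blast
qed

end
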